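(* Let $N=N_{(k)}:\mathbb{C}^n\to\mathbb{C}^n$ be a nilpotent morphism defined by homogeneous forms of degree $k$. Then $N$ possesses at most one fixed point.
   Context: A morphism $N=(N_1,\dots,N_n):\mathbb{C}^n\to\mathbb{C}^n$ is a mapping given by polynomials $N_i\in\mathbb{C}[X_1,\dots,X_n]$. It is nilpotent if its Jacobi matrix $JN(X)=\left(\frac{\partial N_i}{\partial X_j}\right)$ satisfies $(JN(X))^n\equiv 0$ in the ring of $n\times n$ matrices over $\mathbb{C}[X_1,\dots,X_n]$. "Defined by homogeneous forms of degree $k$" means that each $N_i$ is a homogeneous polynomial of degree $k$ (or zero). A fixed point of $N$ is a point $x\in\mathbb{C}^n$ with $N(x)=x$. *)

theory Defs
  imports "HOL-Analysis.Analysis" "HOL-Library.Poly_Mapping"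
begin

text \<open>The polynomial ring in finitely many variables indexed by \<open>'n\<close>: finitely supported
  coefficient functions on exponent vectors, multiplied by convolution (the ring structure
  that \<open>Poly_Mapping\<close> puts on this type).\<close>

type_synonym ('n, 'a) mpoly = "('n \<Rightarrow>\<^sub>0 nat) \<Rightarrow>\<^sub>0 'a"

definition mpoly_eval :: "('n::finite, 'a::comm_semiring_1) mpoly \<Rightarrow> 'a ^ 'n \<Rightarrow> 'a" where
  "mpoly_eval p x =
     (\<Sum>m\<in>Poly_Mapping.keys p. Poly_Mapping.lookup p m * (\<Prod>i\<in>UNIV. (x $ i) ^ Poly_Mapping.lookup m i))"

text \<open>If the variable \<open>i\<close> does not occur in the monomial \<open>m\<close>, then the truncated difference
  of exponents is \<open>m\<close> itself, but the coefficient vanishes.\<close>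

definition mpoly_pderiv :: "'n::finite \<Rightarrow> ('n, 'a::comm_semiring_1) mpoly \<Rightarrow> ('n, 'a) mpoly" where
  "mpoly_pderiv i p =
     (\<Sum>m\<in>Poly_Mapping.keys p.
        Poly_Mapping.single (m - Poly_Mapping.single i 1)
          (of_nat (Poly_Mapping.lookup m i) * Poly_Mapping.lookup p m))"

text \<open>The zero polynomial is homogeneous of every degree.\<close>

definition homogeneous_mpoly :: "nat \<Rightarrow> ('n::finite, 'a::comm_semiring_1) mpoly \<Rightarrow> bool" where
  "homogeneous_mpoly k p \<longleftrightarrow>
     (\<forall>m\<in>Poly_Mapping.keys p. (\<Sum>i\<in>UNIV. Poly_Mapping.lookup m i) = k)"

text \<open>A morphism is represented by its tuple of component polynomials (which, over the complex
  numbers, the mapping determines uniquely); \<open>morphism_map\<close> is the induced mapping.\<close>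

type_synonym 'n morphism = "('n, complex) mpoly ^ 'n"

definition morphism_map :: "'n::finite morphism \<Rightarrow> complex ^ 'n \<Rightarrow> complex ^ 'n" where
  "morphism_map N x = (\<chi> i. mpoly_eval (N $ i) x)"

definition jacobi_matrix :: "'n::finite morphism \<Rightarrow> ('n, complex) mpoly ^ 'n ^ 'n" where
  "jacobi_matrix N = (\<chi> i j. mpoly_pderiv j (N $ i))"

text \<open>The operation \<open>^\<close> on the type of matrices is the componentwise power, hence the
  explicit iteration of the matrix product.\<close>

definition matrix_power :: "'a::semiring_1 ^ 'n ^ 'n::finite \<Rightarrow> nat \<Rightarrow> 'a ^ 'n ^ 'n" where
  "matrix_power A r = ((**) A ^^ r) (mat 1)"

definition nilpotent_morphism :: "'n::finite morphism \<Rightarrow> bool" where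
  "nilpotent_morphism N \<longleftrightarrow> matrix_power (jacobi_matrix N) CARD('n) = 0"

lemma lookup_mpoly_pderiv:
  "Poly_Mapping.lookup (mpoly_pderiv i p) m =
     of_nat (Poly_Mapping.lookup m i + 1) * Poly_Mapping.lookup p (m + Poly_Mapping.single i 1)"
proof -
  let ?e = "Poly_Mapping.single i (1::nat)" and ?L = Poly_Mapping.lookup
  have *: "?L (Poly_Mapping.single (q - ?e) (of_nat (?L q i) * ?L p q)) m =
      (if q = m + ?e then of_nat (?L m i + 1) * ?L p (m + ?e) else 0)" for q
  proof (cases "?L q i = 0")
    case True
    then have "q \<noteq> m + ?e"
      by (auto simp: lookup_add)
    with True show ?thesis by simp
  next
    case False
    then have "q - ?e + ?e = q"
      by (intro poly_mapping_eqI) (auto simp: lookup_add lookup_minus lookup_single when_def)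
    then have "q - ?e = m \<longleftrightarrow> q = m + ?e"
      by (metis add_diff_cancel_right')
    then show ?thesis
      by (auto simp: lookup_single when_def lookup_add)
  qed
  show ?thesis
    unfolding mpoly_pderiv_def lookup_sum
    by (simp only: *) (simp add: sum.delta' in_keys_iff)
qed

end

theory Submission
  imports Defs
begin

text \<open>By Euler's identity, \<open>JN(x) x = k N(x)\<close>. At a fixed point \<open>x\<close> this makes \<open>x\<close> an
  eigenvector of the nilpotent matrix \<open>JN(x)\<close> for the eigenvalue \<open>k\<close>, so \<open>x = 0\<close> unless
  \<open>k = 0\<close>; in the latter case \<open>N\<close> is constant.\<close>

definition monom_eval :: "('n::finite \<Rightarrow>\<^sub>0 nat) \<Rightarrow> 'a::comm_semiring_1 ^ 'n \<Rightarrow> 'a" where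
  "monom_eval m x = (\<Prod>i\<in>UNIV. (x $ i) ^ Poly_Mapping.lookup m i)"

lemma monom_eval_zero [simp]: "monom_eval 0 x = 1"
  by (simp add: monom_eval_def)

lemma monom_eval_add: "monom_eval (m + m') x = monom_eval m x * monom_eval m' x"
  by (simp add: monom_eval_def lookup_add power_add prod.distrib)

lemma monom_eval_single_one: "monom_eval (Poly_Mapping.single i 1) x = x $ i"
proof -
  have "monom_eval (Poly_Mapping.single i 1) x = (\<Prod>j\<in>UNIV. if j = i then x $ j else 1)"
    unfolding monom_eval_def by (intro prod.cong) (auto simp: lookup_single when_def)
  then show ?thesis by simp
qed

text \<open>Indices outside the support contribute zero coefficients. A common index set is needed
  for sums of polynomials, since cancellation can make the support of \<open>p + q\<close> smaller
  than the union of the two supports.\<close>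

lemma mpoly_eval_superset:
  assumes "finite A" "Poly_Mapping.keys p \<subseteq> A"
  shows "mpoly_eval p x = (\<Sum>m\<in>A. Poly_Mapping.lookup p m * monom_eval m x)"
  unfolding mpoly_eval_def monom_eval_def
  using assms by (intro sum.mono_neutral_left) (auto simp: in_keys_iff)

lemma mpoly_eval_zero [simp]: "mpoly_eval 0 x = 0"
  by (simp add: mpoly_eval_def)

lemma mpoly_eval_single [simp]: "mpoly_eval (Poly_Mapping.single m a) x = a * monom_eval m x"
  by (subst mpoly_eval_superset[of "{m}"]) auto

lemma mpoly_eval_one [simp]: "mpoly_eval 1 x = 1"
  using mpoly_eval_single[of 0 1 x] by simp

lemma mpoly_eval_add [simp]: "mpoly_eval (p + q) x = mpoly_eval p x + mpoly_eval q x"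
  using Poly_Mapping.keys_add[of p q]
  by (simp add: mpoly_eval_superset[of "Poly_Mapping.keys p \<union> Poly_Mapping.keys q"]
      lookup_add distrib_right sum.distrib)

lemma mpoly_eval_sum: "mpoly_eval (\<Sum>i\<in>A. f i) x = (\<Sum>i\<in>A. mpoly_eval (f i) x)"
  by (induction A rule: infinite_finite_induct) auto

text \<open>Decomposing a polynomial into its terms reduces the multiplicativity of evaluation to
  products of two terms, where exponents add.\<close>

lemma sum_single_lookup_keys:
  "(\<Sum>m\<in>Poly_Mapping.keys p. Poly_Mapping.single m (Poly_Mapping.lookup p m)) = p"
  by (intro poly_mapping_eqI)
    (simp add: lookup_sum lookup_single when_def in_keys_iff)

lemma mpoly_eval_mult [simp]: "mpoly_eval (p * q) x = mpoly_eval p x * mpoly_eval q x"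
proof -
  let ?L = Poly_Mapping.lookup and ?K = Poly_Mapping.keys
  have "p * q = (\<Sum>m\<in>?K p. Poly_Mapping.single m (?L p m)) *
                (\<Sum>m'\<in>?K q. Poly_Mapping.single m' (?L q m'))"
    by (simp only: sum_single_lookup_keys)
  also have "\<dots> = (\<Sum>m\<in>?K p. \<Sum>m'\<in>?K q. Poly_Mapping.single (m + m') (?L p m * ?L q m'))"
    by (simp add: sum_product mult_single)
  finally have "mpoly_eval (p * q) x =
      (\<Sum>m\<in>?K p. \<Sum>m'\<in>?K q. (?L p m * monom_eval m x) * (?L q m' * monom_eval m' x))"
    by (simp add: mpoly_eval_sum monom_eval_add mult_ac)
  then show ?thesis
    by (simp add: sum_product mpoly_eval_def monom_eval_def)
qed

text \<open>Euler's identity holds term by term: differentiating in the variable \<open>i\<close>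
  and multiplying by \<open>x $ i\<close> scales a monomial by its exponent at \<open>i\<close>, and
  in each monomial of \<open>p\<close> these exponents sum to \<open>k\<close>.\<close>

theorem euler_homogeneous:
  assumes "homogeneous_mpoly k p"
  shows "(\<Sum>i\<in>UNIV. mpoly_eval (mpoly_pderiv i p) x * x $ i) = of_nat k * mpoly_eval p x"
proof -
  let ?L = Poly_Mapping.lookup and ?K = "Poly_Mapping.keys p"
  \<comment> \<open>Subtraction of exponents is truncated. If \<open>i\<close> does not occur in
    \<open>m\<close>, the factor \<open>of_nat (?L m i)\<close> kills both sides; otherwise adding
    the unit exponent back recovers \<open>m\<close>.\<close>
  have *: "of_nat (?L m i) * ?L p m * monom_eval (m - Poly_Mapping.single i 1) x * x $ i =
      of_nat (?L m i) * (?L p m * monom_eval m x)" for m i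
  proof (cases "?L m i = 0")
    case False
    then have "m - Poly_Mapping.single i 1 + Poly_Mapping.single i 1 = m"
      by (intro poly_mapping_eqI) (auto simp: lookup_add lookup_minus lookup_single when_def)
    then have "monom_eval m x = monom_eval (m - Poly_Mapping.single i 1) x * x $ i"
      by (metis monom_eval_add monom_eval_single_one)
    then show ?thesis by (simp add: mult_ac)
  qed simp
  have "(\<Sum>i\<in>UNIV. mpoly_eval (mpoly_pderiv i p) x * x $ i) =
      (\<Sum>i\<in>UNIV. \<Sum>m\<in>?K. of_nat (?L m i) * (?L p m * monom_eval m x))"
    by (simp only: mpoly_pderiv_def mpoly_eval_sum mpoly_eval_single sum_distrib_right *)
  also have "\<dots> = (\<Sum>m\<in>?K. of_nat (\<Sum>i\<in>UNIV. ?L m i) * (?L p m * monom_eval m x))"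
    by (subst sum.swap) (simp add: sum_distrib_right)
  also have "\<dots> = (\<Sum>m\<in>?K. of_nat k * (?L p m * monom_eval m x))"
    using assms by (intro sum.cong) (auto simp: homogeneous_mpoly_def)
  finally show ?thesis
    by (simp add: mpoly_eval_def monom_eval_def sum_distrib_left)
qed

text \<open>Evaluation at a point respects matrix products, so it carries nilpotency from the
  polynomial Jacobi matrix to the scalar matrix at \<open>x\<close>.\<close>

definition matrix_eval :: "('n::finite, 'a::comm_semiring_1) mpoly ^ 'm ^ 'l \<Rightarrow> 'a ^ 'n \<Rightarrow> 'a ^ 'm ^ 'l"
  where "matrix_eval A x = (\<chi> i j. mpoly_eval (A $ i $ j) x)"

lemma matrix_eval_zero [simp]: "matrix_eval 0 x = 0"
  by (simp add: matrix_eval_def vec_eq_iff)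

lemma matrix_eval_mat_one [simp]: "matrix_eval (mat 1) x = mat 1"
  by (simp add: matrix_eval_def mat_def vec_eq_iff)

lemma matrix_eval_mult: "matrix_eval (A ** B) x = matrix_eval A x ** matrix_eval B x"
  by (simp add: matrix_eval_def matrix_matrix_mult_def vec_eq_iff mpoly_eval_sum)

lemma matrix_eval_power: "matrix_eval (matrix_power A r) x = matrix_power (matrix_eval A x) r"
  by (induction r) (simp_all add: matrix_power_def matrix_eval_mult)

lemma matrix_power_eigenvector:
  fixes A :: "'a::comm_semiring_1 ^ 'n ^ 'n::finite"
  assumes "A *v x = c *s x"
  shows "matrix_power A r *v x = c ^ r *s x"
proof (induction r)
  case (Suc r)
  have "matrix_power A (Suc r) *v x = A *v (matrix_power A r *v x)"
    by (simp add: matrix_power_def matrix_vector_mul_assoc)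
  also have "\<dots> = c ^ r *s (A *v x)"
    unfolding Suc by (simp add: matrix_vector_mult_def vector_scalar_mult_def vec_eq_iff
        sum_distrib_left mult_ac)
  finally show ?case
    by (simp add: assms vector_smult_assoc mult_ac)
qed (simp add: matrix_power_def)

text \<open>Row \<open>i\<close> is Euler's identity for \<open>N $ i\<close>, with the value of
  \<open>N $ i\<close> at \<open>x\<close> replaced by \<open>x $ i\<close>.\<close>

lemma homogeneous_fixed_point_eigenvector:
  assumes "\<And>i. homogeneous_mpoly k (N $ i)" "morphism_map N x = x"
  shows "matrix_eval (jacobi_matrix N) x *v x = of_nat k *s x"
  using assms(2) euler_homogeneous[OF assms(1)]
  by (simp add: matrix_eval_def jacobi_matrix_def matrix_vector_mult_def vec_eq_iff
      morphism_map_def)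

lemma mpoly_eval_homogeneous_zero:
  assumes "homogeneous_mpoly 0 p"
  shows "mpoly_eval p x = mpoly_eval p y"
  unfolding mpoly_eval_def using assms by (intro sum.cong) (auto simp: homogeneous_mpoly_def)

theorem proposition2:
  fixes N :: "'n::finite morphism" and k :: nat
  assumes "nilpotent_morphism N"
    and "\<And>i. homogeneous_mpoly k (N $ i)"
  shows "\<exists>\<^sub>\<le>\<^sub>1 x. morphism_map N x = x"
proof (cases "k = 0")
  case True
  \<comment> \<open>The eigenvalue is 0 here and gives no information, but two fixed points of a
    constant map both equal its value.\<close>
  then have "morphism_map N x = morphism_map N y" for x y
    unfolding morphism_map_def vec_eq_iff
    using assms(2) by (auto intro: mpoly_eval_homogeneous_zero)
  then show ?thesis
    unfolding Uniq_def by metis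
next
  case False
  have "x = 0" if "morphism_map N x = x" for x
  proof -
    have "of_nat k ^ CARD('n) *s x = matrix_power (matrix_eval (jacobi_matrix N) x) CARD('n) *v x"
      by (rule matrix_power_eigenvector[symmetric])
        (rule homogeneous_fixed_point_eigenvector[OF assms(2) that])
    also have "\<dots> = 0"
      using assms(1) by (simp add: nilpotent_morphism_def flip: matrix_eval_power)
    finally show ?thesis
      \<comment> \<open>The scalar \<open>of_nat k ^ CARD('n)\<close> is nonzero because the complex
        numbers have characteristic 0, so it can be cancelled.\<close>
      using False by simp
  qed
  then show ?thesis
    unfolding Uniq_def by blast
qed

end
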